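(* Let $f,g$ be proper, convex and lower semicontinuous functions on $\mathbb{R}^n$, and let $t>0$. Consider the HJ-Prox-based Douglas–Rachford splitting iteration $$x_{k+1/2}=\operatorname{prox}^{\delta_k}_{tf}(z_k),\qquad x_{k+1}=\operatorname{prox}^{\delta_k}_{tg}(2x_{k+1/2}-z_k),\qquad z_{k+1}=z_k+x_{k+1}-x_{k+1/2},$$ with $\{\sqrt{\delta_k}\}_{k\ge1}$ a summable sequence ($\delta_k>0$). Then $x_k$ converges to a minimizer of $f+g$.
   Context: For a function $\varphi$ on $\mathbb{R}^n$, $t>0$ and $\delta>0$, the HJ-Prox of $\varphi$ is the map $$\operatorname{prox}^{\delta}_{t\varphi}(x)=\frac{\mathbb{E}_{y\sim\mathcal{N}(x,\delta tI)}\left[y\,\exp(-\varphi(y)/\delta)\right]}{\mathbb{E}_{y\sim\mathcal{N}(x,\delta tI)}\left[\exp(-\varphi(y)/\delta)\right]},$$ where $\mathcal{N}(x,\delta tI)$ is the Gaussian distribution on $\mathbb{R}^n$ with mean $x$ and covariance matrix $\delta tI$. It is an approximation of the proximal operator $\operatorname{prox}_{t\varphi}(x)=\arg\min_{z}\{\varphi(z)+\frac{1}{2t}\|z-x\|^2\}$. The expectations are evaluated exactly (no Monte Carlo sampling error).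
   Formalization: The formal theorem also assumes that 0 ∈ ∂f(p)+∂g(p) for some p (without it the claim fails, e.g. f(x)=x, g=0 has no minimizer) and that the denominators in the HJ-Prox steps are nonzero, so that the quotients are defined. *)

theory Defs
  imports "HOL-Probability.Probability"
begin

(* Extended-real-valued functions take values in (-\<infinity>, \<infinity>]; the first clause of proper excludes -\<infinity>. *)

definition proper :: "('a \<Rightarrow> ereal) \<Rightarrow> bool" where
  "proper \<phi> \<longleftrightarrow> (\<forall>x. \<phi> x \<noteq> - \<infinity>) \<and> (\<exists>x. \<phi> x < \<infinity>)"

(* The ereal convention 0 * \<infinity> = 0 makes the cases u = 0 and v = 0 trivial. *)
definition convex_ereal :: "('a::real_vector \<Rightarrow> ereal) \<Rightarrow> bool" where
  "convex_ereal \<phi> \<longleftrightarrow> (\<forall>x y. \<forall>u\<ge>0. \<forall>v\<ge>0. u + v = 1 \<longrightarrow>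
     \<phi> (u *\<^sub>R x + v *\<^sub>R y) \<le> ereal u * \<phi> x + ereal v * \<phi> y)"

definition lower_semicontinuous :: "('a::topological_space \<Rightarrow> ereal) \<Rightarrow> bool" where
  "lower_semicontinuous \<phi> \<longleftrightarrow> (\<forall>x. \<phi> x \<le> Liminf (at x) \<phi>)"

definition subdifferential :: "('a::real_inner \<Rightarrow> ereal) \<Rightarrow> 'a \<Rightarrow> 'a set" where
  "subdifferential \<phi> x = {u. \<forall>y. \<phi> x + ereal (u \<bullet> (y - x)) \<le> \<phi> y}"

(* The normal distribution with mean x and covariance v I (v is the variance, not the standard
   deviation): its coordinates are independent one-dimensional normals. *)
definition isotropic_gaussian :: "'a::euclidean_space \<Rightarrow> real \<Rightarrow> 'a measure" where
  "isotropic_gaussian x v =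
     density lborel (\<lambda>y. ennreal (\<Prod>b\<in>Basis. normal_density (x \<bullet> b) (sqrt v) (y \<bullet> b)))"

(* exp (- r / \<delta>), with exp (-\<infinity>) = 0.  Only meant for r \<noteq> -\<infinity>, since real_of_ereal (-\<infinity>) = 0. *)
definition gibbs_weight :: "real \<Rightarrow> ereal \<Rightarrow> real" where
  "gibbs_weight \<delta> r = (if r = \<infinity> then 0 else exp (- real_of_ereal r / \<delta>))"

definition hj_normalizer :: "('a::euclidean_space \<Rightarrow> ereal) \<Rightarrow> real \<Rightarrow> real \<Rightarrow> 'a \<Rightarrow> real" where
  "hj_normalizer \<phi> t \<delta> x = (LINT y|isotropic_gaussian x (\<delta> * t). gibbs_weight \<delta> (\<phi> y))"

(* A quotient of expectations; it is meaningful only if hj_normalizer \<phi> t \<delta> x \<noteq> 0.  For proper,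
   convex, lower semicontinuous \<phi> and t, \<delta> > 0 the normalizer vanishes exactly when the effective
   domain of \<phi> is Lebesgue-null. *)
definition hj_prox :: "('a::euclidean_space \<Rightarrow> ereal) \<Rightarrow> real \<Rightarrow> real \<Rightarrow> 'a \<Rightarrow> 'a" where
  "hj_prox \<phi> t \<delta> x =
     (LINT y|isotropic_gaussian x (\<delta> * t). gibbs_weight \<delta> (\<phi> y) *\<^sub>R y) /\<^sub>R hj_normalizer \<phi> t \<delta> x"

end

theory Submission
  imports Defs
begin

text \<open>
  With p the exact proximal point of x, the density w proportional to
  exp (- (\<phi> y + |y - x|^2 / (2 t)) / \<delta>) is strongly log-concave with mode p, so contracting its
  argument towards p multiplies it by at least exp ((1 - l^2) |y - p|^2 / (2 \<delta> t)).
  Integrating and changing variables on the left bounds the second moment of w around p by a multiple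
  of \<delta>; hence the HJ-Prox differs from the exact prox by O(sqrt \<delta>), without any smoothness of \<phi>.
  The iteration is therefore Douglas-Rachford with summable errors: the exact operator is firmly
  nonexpansive, the perturbed iterates are quasi-Fejer monotone with respect to its fixed points, and
  the prox of a fixed point minimizes f + g.
\<close>

section \<open>Subgradients and exact proximal points\<close>

lemma subdifferentialD: "u \<in> subdifferential \<phi> x \<Longrightarrow> \<phi> x + ereal (u \<bullet> (y - x)) \<le> \<phi> y"
  by (simp add: subdifferential_def)

lemma subdifferential_finite:
  assumes "proper \<phi>" "u \<in> subdifferential \<phi> p"
  obtains r where "\<phi> p = ereal r"
proof -
  obtain y where y: "\<phi> y < \<infinity>" using assms(1) by (auto simp: proper_def)
  have "\<phi> p \<noteq> \<infinity>" using subdifferentialD[OF assms(2), of y] y by auto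
  moreover have "\<phi> p \<noteq> -\<infinity>" using assms(1) by (auto simp: proper_def)
  ultimately show thesis using that by (cases "\<phi> p") auto
qed

text \<open>A real \<open>a\<close> strictly between \<open>r y\<close> and \<open>\<phi> y\<close>
  keeps the two apart on a neighbourhood. With a continuous \<open>r\<close> instead of a constant,
  a quadratic can be moved across the inequality, which covers superlevel sets of
  \<open>\<phi>\<close> plus a quadratic.\<close>

lemma lower_semicontinuous_open:
  fixes r :: "'a::topological_space \<Rightarrow> real"
  assumes "lower_semicontinuous \<phi>" and r: "continuous_on UNIV r"
  shows "open {y. ereal (r y) < \<phi> y}"
proof (subst open_subopen, safe)
  fix y assume "ereal (r y) < \<phi> y"
  then obtain a where a: "ereal (r y) < ereal a" "ereal a < \<phi> y"
    using ereal_dense2 by blast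
  have "ereal a < Liminf (at y) \<phi>"
    using a(2) assms(1) by (auto simp: lower_semicontinuous_def intro: less_le_trans)
  then have "\<forall>\<^sub>F z in at y. ereal a < \<phi> z" by (rule less_LiminfD)
  \<comment> \<open>\<open>Liminf (at y)\<close> says nothing about the point \<open>y\<close>
    itself, where \<open>a(2)\<close> takes over.\<close>
  with a(2) have "\<forall>\<^sub>F z in nhds y. ereal a < \<phi> z"
    by (auto simp: eventually_at_filter elim: eventually_mono)
  moreover have "open {z. r z < a}" using r by (intro open_Collect_less continuous_intros)
  then have "\<forall>\<^sub>F z in nhds y. r z < a" using a(1) eventually_nhds_in_open[of "{z. r z < a}" y] by simp
  ultimately have "\<forall>\<^sub>F z in nhds y. ereal (r z) < \<phi> z"
  proof eventually_elim
    case (elim z)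
    then show ?case using less_trans[of "ereal (r z)" "ereal a" "\<phi> z"] by simp
  qed
  then show "\<exists>T. open T \<and> y \<in> T \<and> T \<subseteq> {y. ereal (r y) < \<phi> y}"
    unfolding eventually_nhds by blast
qed

text \<open>Without a minimizer the open sets \<open>{y. h c < h y}\<close> with
  \<open>c \<in> K\<close> would cover \<open>K\<close>, but in a finite subcover a centre of least
  value is left uncovered. Openness is asked only for \<open>c\<close> in \<open>K\<close>, where
  the function \<open>H\<close> of the next proof is finite.\<close>

lemma compact_attains_inf_of_open_superlevels:
  fixes h :: "'a::topological_space \<Rightarrow> 'b::linorder"
  assumes "compact K" "K \<noteq> {}" and op: "\<And>c. c \<in> K \<Longrightarrow> open {y. h c < h y}"
  obtains p where "p \<in> K" "\<And>y. y \<in> K \<Longrightarrow> h p \<le> h y"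
proof (rule ccontr)
  assume "\<not> thesis"
  then have "\<forall>p\<in>K. \<exists>y\<in>K. h y < h p" using that by (meson not_le)
  then have "K \<subseteq> (\<Union>c\<in>K. {y. h c < h y})" by blast
  then obtain C where C: "C \<subseteq> K" "finite C" "K \<subseteq> (\<Union>c\<in>C. {y. h c < h y})"
    using compactE_image[OF assms(1), of K "\<lambda>c. {y. h c < h y}"] op by blast
  have "C \<noteq> {}" using C(3) assms(2) by auto
  then have "Min (h ` C) \<in> h ` C" using C(2) by simp
  then obtain c where c: "c \<in> C" "h c = Min (h ` C)" by auto
  then obtain c' where "c' \<in> C" "h c' < h c" using C by blast
  then show False using c C(2) by (simp add: leD)
qed

text \<open>The inclusion is the optimality condition for the proximal point. The subgradient
  \<open>u\<close> supplies an affine minorant and hence coercivity, lower semicontinuity gives a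
  minimizer, and convexity on segments turns minimality into the inclusion.\<close>

lemma prox_exists:
  fixes \<phi> :: "'a::euclidean_space \<Rightarrow> ereal"
  assumes \<phi>: "proper \<phi>" "convex_ereal \<phi>" "lower_semicontinuous \<phi>"
    and t: "t > 0" and u: "u \<in> subdifferential \<phi> q"
  shows "\<exists>p. (x - p) /\<^sub>R t \<in> subdifferential \<phi> p"
proof -
  define H where "H y = \<phi> y + ereal ((norm (y - x))\<^sup>2 / (2 * t))" for y
  obtain rq where rq: "\<phi> q = ereal rq" using subdifferential_finite[OF \<phi>(1) u] .
  have ninf: "\<phi> y \<noteq> -\<infinity>" for y using \<phi>(1) by (auto simp: proper_def)
  define K where "K = {y. H y \<le> H q}"
  have op: "open {y. H c < H y}" if c: "c \<in> K" for c
  proof -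
    have "H c \<noteq> \<infinity>" using c by (auto simp: K_def H_def rq)
    moreover have "H c \<noteq> -\<infinity>" by (simp add: H_def ninf)
    ultimately obtain a where a: "H c = ereal a" by (cases "H c") auto
    have "ereal a < H y \<longleftrightarrow> ereal (a - (norm (y - x))\<^sup>2 / (2 * t)) < \<phi> y" for y
      unfolding H_def by (cases "\<phi> y") auto
    then show ?thesis
      using lower_semicontinuous_open[OF \<phi>(3), of "\<lambda>y. a - (norm (y - x))\<^sup>2 / (2 * t)"] t
      by (simp add: a continuous_intros)
  qed
  have qK: "q \<in> K" by (simp add: K_def)
  have "closed K"
  proof -
    have "K = - {y. H q < H y}" by (auto simp: K_def)
    then show ?thesis using closed_Compl[OF op[OF qK]] by simp
  qed
  moreover have "bounded K"
  proof -
    \<comment> \<open>\<open>B\<close> comes from completing the square: the minorant at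
      \<open>q\<close> turns \<open>H y \<le> H q\<close> into a bound on the squared distance from
      \<open>y\<close> to \<open>x - t *\<^sub>R u\<close>.\<close>
    define B where "B = (norm (q - x))\<^sup>2 - 2 * t * (u \<bullet> (x - q)) + (t * norm u)\<^sup>2"
    have "norm (y - (x - t *\<^sub>R u)) \<le> sqrt B" if "y \<in> K" for y
    proof -
      have "ereal (rq + u \<bullet> (y - q) + (norm (y - x))\<^sup>2 / (2 * t)) \<le> H y"
        using subdifferentialD[OF u, of y] unfolding H_def rq
        by (cases "\<phi> y") auto
      also have "H y \<le> ereal (rq + (norm (q - x))\<^sup>2 / (2 * t))"
        using that by (simp add: K_def H_def rq)
      finally have 1: "u \<bullet> (y - q) + (norm (y - x))\<^sup>2 / (2 * t) \<le> (norm (q - x))\<^sup>2 / (2 * t)"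
        by simp
      have "2 * t * (u \<bullet> (y - q)) + (norm (y - x))\<^sup>2
          = 2 * t * (u \<bullet> (y - q) + (norm (y - x))\<^sup>2 / (2 * t))"
        using t by (simp only: distrib_left) simp
      also have "\<dots> \<le> 2 * t * ((norm (q - x))\<^sup>2 / (2 * t))"
        using 1 t by (intro mult_left_mono) auto
      also have "\<dots> = (norm (q - x))\<^sup>2" using t by simp
      finally have 2: "2 * t * (u \<bullet> (y - q)) + (norm (y - x))\<^sup>2 \<le> (norm (q - x))\<^sup>2" .
      have "2 * t * (u \<bullet> (y - q)) = 2 * t * (u \<bullet> (y - x)) + 2 * t * (u \<bullet> (x - q))"
        by (simp add: inner_diff_right flip: distrib_left)
      with 2 have "(norm (y - x))\<^sup>2 + 2 * t * (u \<bullet> (y - x)) + (t * norm u)\<^sup>2 \<le> B"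
        unfolding B_def by linarith
      moreover have "(norm ((y - x) + t *\<^sub>R u))\<^sup>2
          = (norm (y - x))\<^sup>2 + 2 * t * (u \<bullet> (y - x)) + (t * norm u)\<^sup>2"
        unfolding power_mult_distrib power2_norm_eq_inner inner_add_left inner_add_right
        by (simp add: inner_commute power2_eq_square)
      ultimately have "norm ((y - x) + t *\<^sub>R u) \<le> sqrt B" by (intro real_le_rsqrt) simp
      then show ?thesis by (simp add: diff_diff_eq2 diff_add_eq)
    qed
    then have "K \<subseteq> cball (x - t *\<^sub>R u) (sqrt B)" by (auto simp: dist_norm norm_minus_commute)
    then show ?thesis by (rule bounded_subset[OF bounded_cball])
  qed
  ultimately have "compact K" by (simp add: compact_eq_bounded_closed)
  then obtain p where p: "p \<in> K" "\<And>y. y \<in> K \<Longrightarrow> H p \<le> H y"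
    using compact_attains_inf_of_open_superlevels[of K H] op qK by blast
  have pmin: "H p \<le> H y" for y
    using p unfolding K_def by (metis linear mem_Collect_eq order_trans)
  have "H p \<noteq> \<infinity>" using p(1) by (auto simp: K_def H_def rq)
  then obtain rp where rp: "\<phi> p = ereal rp"
    using ninf[of p] by (cases "\<phi> p") (auto simp: H_def)
  have "\<phi> p + ereal (((x - p) /\<^sub>R t) \<bullet> (y - p)) \<le> \<phi> y" for y
  proof (cases "\<phi> y = \<infinity>")
    case False
    then obtain ry where ry: "\<phi> y = ereal ry" using ninf[of y] by (cases "\<phi> y") auto
    define d where "d = y - p"
    \<comment> \<open>Comparing \<open>H p\<close> with \<open>H\<close> at
      \<open>p + l *\<^sub>R d\<close> gives a first-order term in \<open>l\<close> against a
      remainder of order \<open>l^2\<close>. After division by \<open>l\<close> the remainder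
      vanishes as \<open>l\<close> tends to 0.\<close>
    have "rp - ry + ((x - p) \<bullet> d) / t \<le> l * ((norm d)\<^sup>2 / (2 * t))" if l: "0 < l" "l < 1" for l
    proof -
      have "\<phi> ((1 - l) *\<^sub>R p + l *\<^sub>R y) \<le> ereal (1 - l) * \<phi> p + ereal l * \<phi> y"
        using \<phi>(2) l unfolding convex_ereal_def by simp
      moreover have "(1 - l) *\<^sub>R p + l *\<^sub>R y = p + l *\<^sub>R d" by (simp add: d_def algebra_simps)
      ultimately have "\<phi> (p + l *\<^sub>R d) \<le> ereal ((1 - l) * rp + l * ry)" by (simp add: rp ry)
      then have "H (p + l *\<^sub>R d) \<le> ereal ((1 - l) * rp + l * ry) + ereal ((norm (p + l *\<^sub>R d - x))\<^sup>2 / (2 * t))"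
        unfolding H_def by (rule add_right_mono)
      from order_trans[OF pmin this]
      have "rp + (norm (p - x))\<^sup>2 / (2 * t)
          \<le> (1 - l) * rp + l * ry + (norm (p + l *\<^sub>R d - x))\<^sup>2 / (2 * t)"
        by (simp only: H_def rp plus_ereal.simps ereal_less_eq)
      moreover have "(norm ((p - x) + l *\<^sub>R d))\<^sup>2 = (norm (p - x))\<^sup>2 + 2 * l * ((p - x) \<bullet> d) + l\<^sup>2 * (norm d)\<^sup>2"
        unfolding power2_norm_eq_inner inner_add_left inner_add_right
        by (simp add: inner_commute power2_eq_square)
      moreover have "p + l *\<^sub>R d - x = (p - x) + l *\<^sub>R d" by simp
      moreover have "(p - x) \<bullet> d = - ((x - p) \<bullet> d)" by (simp add: inner_diff_left)
      ultimately have "rp + (norm (p - x))\<^sup>2 / (2 * t) \<le> (1 - l) * rp + l * ry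
          + ((norm (p - x))\<^sup>2 / (2 * t) - l * (((x - p) \<bullet> d) / t) + l * (l * ((norm d)\<^sup>2 / (2 * t))))"
        using t by (simp add: add_divide_distrib diff_divide_distrib power2_eq_square)
      then have "l * (rp - ry + ((x - p) \<bullet> d) / t) \<le> l * (l * ((norm d)\<^sup>2 / (2 * t)))"
        by (simp add: algebra_simps)
      then show ?thesis using l by (simp only: mult_le_cancel_left_pos)
    qed
    then have ev: "\<forall>\<^sub>F l in at_right 0. rp - ry + ((x - p) \<bullet> d) / t \<le> l * ((norm d)\<^sup>2 / (2 * t))"
      by (intro eventually_at_rightI[of 0 1]) auto
    have "((\<lambda>l. l * ((norm d)\<^sup>2 / (2 * t))) \<longlongrightarrow> 0 * ((norm d)\<^sup>2 / (2 * t))) (at_right 0)"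
      by (intro tendsto_intros)
    from tendsto_lowerbound[OF this ev]
    have "rp - ry + ((x - p) \<bullet> d) / t \<le> 0" by simp
    moreover have "((x - p) /\<^sub>R t) \<bullet> d = ((x - p) \<bullet> d) / t" by (simp add: divide_inverse)
    ultimately show ?thesis by (simp add: rp ry flip: d_def)
  qed simp
  then show ?thesis by (auto simp: subdifferential_def)
qed

text \<open>Monotonicity of the subdifferential: the subgradient inequality at \<open>p\<close>
  tested at \<open>q\<close> and the one at \<open>q\<close> tested at \<open>p\<close> are added,
  so that the function values cancel.\<close>

lemma prox_firmly_nonexpansive:
  assumes \<phi>: "proper \<phi>" and t: "t > 0"
    and p: "(x - p) /\<^sub>R t \<in> subdifferential \<phi> p" and q: "(y - q) /\<^sub>R t \<in> subdifferential \<phi> q"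
  shows "(p - q) \<bullet> (p - q) \<le> (p - q) \<bullet> (x - y)"
proof -
  obtain a where a: "\<phi> p = ereal a" using subdifferential_finite[OF \<phi> p] .
  obtain b where b: "\<phi> q = ereal b" using subdifferential_finite[OF \<phi> q] .
  have "(x - p) \<bullet> (q - p) / t \<le> b - a" "(y - q) \<bullet> (p - q) / t \<le> a - b"
    using subdifferentialD[OF p, of q] subdifferentialD[OF q, of p]
    by (simp_all add: a b divide_inverse algebra_simps)
  then have "(x - p) \<bullet> (q - p) / t + (y - q) \<bullet> (p - q) / t \<le> 0" by simp
  then have "(x - p) \<bullet> (q - p) + (y - q) \<bullet> (p - q) \<le> 0"
    using t by (simp add: add_divide_distrib[symmetric] divide_le_0_iff)
  then show ?thesis by (simp add: inner_simps inner_commute)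
qed

text \<open>Cauchy-Schwarz applied to firm nonexpansiveness. The case \<open>x = y\<close> is
  uniqueness of the proximal point.\<close>

lemma prox_nonexpansive:
  assumes "proper \<phi>" "t > 0"
    and "(x - p) /\<^sub>R t \<in> subdifferential \<phi> p" "(y - q) /\<^sub>R t \<in> subdifferential \<phi> q"
  shows "norm (p - q) \<le> norm (x - y)"
proof -
  have "norm (p - q) * norm (p - q) \<le> norm (p - q) * norm (x - y)"
    using prox_firmly_nonexpansive[OF assms] norm_cauchy_schwarz[of "p - q" "x - y"]
    unfolding power2_norm_eq_inner[symmetric] power2_eq_square by linarith
  then show ?thesis by (cases "norm (p - q) = 0") auto
qed

section \<open>Affine substitution for Lebesgue measure and the Gaussian density\<close>

lemma lborel_integrable_affine:
  fixes f :: "'a::euclidean_space \<Rightarrow> 'b::{banach, second_countable_topology}"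
  assumes c: "c \<noteq> 0" and f: "integrable lborel f"
  shows "integrable lborel (\<lambda>x. f (a + c *\<^sub>R x))"
proof -
  have [measurable]: "f \<in> borel_measurable borel" using f by auto
  have "integrable (density (distr lborel borel (\<lambda>x. a + c *\<^sub>R x)) (\<lambda>_. ennreal (\<bar>c\<bar>^DIM('a)))) f"
    using f lborel_affine[OF c, of a] by (simp add: ennreal_power)
  then have "integrable lborel (\<lambda>x. \<bar>c\<bar>^DIM('a) *\<^sub>R f (a + c *\<^sub>R x))"
    by (simp add: integrable_density integrable_distr_eq)
  from integrable_scaleR_right[OF this, of "inverse (\<bar>c\<bar>^DIM('a))"] show ?thesis using c by simp
qed

lemma lborel_integral_affine:
  fixes f :: "'a::euclidean_space \<Rightarrow> 'b::{banach, second_countable_topology}"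
  assumes c: "c \<noteq> 0" and f: "f \<in> borel_measurable borel"
  shows "(\<integral>x. f x \<partial>lborel) = \<bar>c\<bar>^DIM('a) *\<^sub>R (\<integral>x. f (a + c *\<^sub>R x) \<partial>lborel)"
proof -
  have "(\<integral>x. f x \<partial>lborel)
      = (\<integral>x. f x \<partial>density (distr lborel borel (\<lambda>x. a + c *\<^sub>R x)) (\<lambda>_. ennreal (\<bar>c\<bar>^DIM('a))))"
    using lborel_affine[OF c, of a] by (simp add: ennreal_power)
  then show ?thesis using f by (simp add: integral_density integral_distr)
qed

lemma isotropic_gaussian_eq:
  fixes x :: "'a::euclidean_space"
  assumes "v > 0"
  shows "isotropic_gaussian x v = density lborel
    (\<lambda>y. ennreal ((1 / sqrt (2 * pi * v)) ^ DIM('a) * exp (- (norm (y - x))\<^sup>2 / (2 * v))))"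
proof -
  have "(\<Prod>b\<in>Basis. normal_density (x \<bullet> b) (sqrt v) (y \<bullet> b))
      = (1 / sqrt (2 * pi * v)) ^ DIM('a) * exp (- (norm (y - x))\<^sup>2 / (2 * v))" for y
  proof -
    have "(norm (y - x))\<^sup>2 = (\<Sum>b\<in>Basis. (y \<bullet> b - x \<bullet> b)\<^sup>2)"
      unfolding power2_norm_eq_inner
      by (subst euclidean_inner) (simp add: inner_diff_left power2_eq_square)
    then have "exp (- (norm (y - x))\<^sup>2 / (2 * v)) = (\<Prod>b\<in>Basis. exp (- (y \<bullet> b - x \<bullet> b)\<^sup>2 / (2 * v)))"
      by (simp add: exp_sum[symmetric] sum_negf sum_divide_distrib)
    then show ?thesis
      using assms by (simp add: normal_density_def prod_dividef power_divide)
  qed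
  then show ?thesis by (simp add: isotropic_gaussian_def)
qed

section \<open>Distance between the HJ-Prox and the exact prox\<close>

text \<open>Convexity between \<open>p\<close> and \<open>y\<close> leaves a cross term from the
  Gaussian exponent; the subgradient inequality at \<open>p\<close> absorbs it, and a gain
  proportional to \<open>(1 - l^2) |y - p|^2\<close> remains. The exponential of this gain is
  weakened by \<open>1 + s \<le> exp s\<close>, which is enough for second moments.\<close>

lemma scaled_gibbs_weight_ge:
  fixes \<phi> :: "'a::euclidean_space \<Rightarrow> ereal"
  defines "w \<equiv> (\<lambda>\<delta> t x y. gibbs_weight \<delta> (\<phi> y) * exp (- (norm (y - x))\<^sup>2 / (2 * (\<delta> * t))))"
  assumes \<phi>: "proper \<phi>" "convex_ereal \<phi>" and t: "t > 0" and \<delta>: "\<delta> > 0"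
    and p: "(x - p) /\<^sub>R t \<in> subdifferential \<phi> p" and l: "0 \<le> l" "l \<le> 1"
  shows "w \<delta> t x y * (1 + (1 - l\<^sup>2) * (norm (y - p))\<^sup>2 / (2 * (\<delta> * t))) \<le> w \<delta> t x (p + l *\<^sub>R (y - p))"
proof (cases "\<phi> y = \<infinity>")
  case True
  then show ?thesis by (simp add: w_def gibbs_weight_def)
next
  case False
  have ninf: "\<phi> z \<noteq> -\<infinity>" for z using \<phi>(1) by (auto simp: proper_def)
  obtain a where a: "\<phi> p = ereal a" using subdifferential_finite[OF \<phi>(1) p] .
  obtain b where b: "\<phi> y = ereal b" using False ninf[of y] by (cases "\<phi> y") auto
  define d where "d = y - p"
  have "\<phi> ((1 - l) *\<^sub>R p + l *\<^sub>R y) \<le> ereal (1 - l) * \<phi> p + ereal l * \<phi> y"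
    using \<phi>(2) l unfolding convex_ereal_def by simp
  moreover have "(1 - l) *\<^sub>R p + l *\<^sub>R y = p + l *\<^sub>R d" by (simp add: d_def algebra_simps)
  ultimately have le: "\<phi> (p + l *\<^sub>R d) \<le> ereal ((1 - l) * a + l * b)" by (simp add: a b)
  then obtain c where c: "\<phi> (p + l *\<^sub>R d) = ereal c"
    using ninf[of "p + l *\<^sub>R d"] by (cases "\<phi> (p + l *\<^sub>R d)") auto
  have "a + ((x - p) \<bullet> d) / t \<le> b"
    using subdifferentialD[OF p, of y] by (simp add: a b d_def divide_inverse mult.commute)
  \<comment> \<open>The weight \<open>1 - l\<close> matches the convexity bound \<open>le\<close>,
    so that \<open>a\<close> drops out and only \<open>b\<close> and \<open>c\<close>
    remain.\<close>
  then have "(1 - l) * (a + ((x - p) \<bullet> d) / t) \<le> (1 - l) * b"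
    using l by (intro mult_left_mono) auto
  then have "c + (1 - l) * (((x - p) \<bullet> d) / t) \<le> b"
    using le by (simp add: c algebra_simps)
  then have "c * t + (1 - l) * ((x - p) \<bullet> d) \<le> b * t"
    using t mult_right_mono[of _ b t] by (fastforce simp: field_simps)
  moreover have "(norm (p + l *\<^sub>R d - x))\<^sup>2
      = (norm (y - x))\<^sup>2 - (1 - l\<^sup>2) * (norm d)\<^sup>2 + 2 * (1 - l) * ((x - p) \<bullet> d)"
  proof -
    have n: "(norm (d' - e))\<^sup>2 = (norm d')\<^sup>2 + (norm e)\<^sup>2 - 2 * (e \<bullet> d')" for d' e :: 'a
      unfolding power2_norm_eq_inner inner_diff_left inner_diff_right by (simp add: inner_commute)
    have "p + l *\<^sub>R d - x = l *\<^sub>R d - (x - p)" "y - x = d - (x - p)" by (simp_all add: d_def)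
    then show ?thesis by (simp only: n) (simp add: algebra_simps power_mult_distrib)
  qed
  ultimately have "2 * (c * t) + (norm (p + l *\<^sub>R d - x))\<^sup>2
      \<le> 2 * (b * t) + (norm (y - x))\<^sup>2 - (1 - l\<^sup>2) * (norm d)\<^sup>2"
    by linarith
  then have "(2 * (c * t) + (norm (p + l *\<^sub>R d - x))\<^sup>2) / (2 * (\<delta> * t))
      \<le> (2 * (b * t) + (norm (y - x))\<^sup>2 - (1 - l\<^sup>2) * (norm d)\<^sup>2) / (2 * (\<delta> * t))"
    using t \<delta> by (intro divide_right_mono) auto
  then have ex: "(- b / \<delta> + - (norm (y - x))\<^sup>2 / (2 * (\<delta> * t))) + (1 - l\<^sup>2) * (norm d)\<^sup>2 / (2 * (\<delta> * t))
      \<le> - c / \<delta> + - (norm (p + l *\<^sub>R d - x))\<^sup>2 / (2 * (\<delta> * t))"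
    using t \<delta> by (simp add: add_divide_distrib diff_divide_distrib)
  have "w \<delta> t x y * (1 + (1 - l\<^sup>2) * (norm d)\<^sup>2 / (2 * (\<delta> * t)))
      \<le> w \<delta> t x y * exp ((1 - l\<^sup>2) * (norm d)\<^sup>2 / (2 * (\<delta> * t)))"
    by (intro mult_left_mono exp_ge_add_one_self) (simp add: w_def gibbs_weight_def)
  also have "\<dots> = exp ((- b / \<delta> + - (norm (y - x))\<^sup>2 / (2 * (\<delta> * t)))
      + (1 - l\<^sup>2) * (norm d)\<^sup>2 / (2 * (\<delta> * t)))"
    by (simp add: w_def gibbs_weight_def b mult_exp_exp)
  also have "\<dots> \<le> exp (- c / \<delta> + - (norm (p + l *\<^sub>R d - x))\<^sup>2 / (2 * (\<delta> * t)))"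
    using ex by (simp only: exp_le_cancel_iff)
  also have "\<dots> = w \<delta> t x (p + l *\<^sub>R d)"
    by (simp add: w_def gibbs_weight_def c mult_exp_exp)
  finally show ?thesis by (simp add: d_def)
qed

text \<open>The bound is uniform in \<open>x\<close>, so summability of \<open>sqrt \<delta>\<close>
  carries over to the errors along the iteration. The constant combines the contraction by
  \<open>l = 1/2\<close>, whose substitution costs \<open>2 ^ DIM('a)\<close>, with the passage from
  second to first moments.\<close>

lemma hj_prox_error:
  fixes \<phi> :: "'a::euclidean_space \<Rightarrow> ereal"
  assumes \<phi>: "proper \<phi>" "convex_ereal \<phi>" and t: "t > 0" and \<delta>: "\<delta> > 0"
    and p: "(x - p) /\<^sub>R t \<in> subdifferential \<phi> p" and N: "hj_normalizer \<phi> t \<delta> x \<noteq> 0"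
  shows "norm (hj_prox \<phi> t \<delta> x - p) \<le> (t * 2 ^ (DIM('a) + 2) + 1) * sqrt \<delta>"
proof -
  define \<gamma> where "\<gamma> y = (1 / sqrt (2 * pi * (\<delta> * t))) ^ DIM('a) * exp (- (norm (y - x))\<^sup>2 / (2 * (\<delta> * t)))" for y
  define w where "w y = gibbs_weight \<delta> (\<phi> y) * exp (- (norm (y - x))\<^sup>2 / (2 * (\<delta> * t)))" for y
  define W where "W = (\<integral>y. w y \<partial>lborel)"
  define c where "c = (1 / sqrt (2 * pi * (\<delta> * t))) ^ DIM('a)"
  have c: "c > 0" using t \<delta> by (simp add: c_def)
  have ig: "isotropic_gaussian x (\<delta> * t) = density lborel (\<lambda>y. ennreal (\<gamma> y))"
    using t \<delta> by (simp add: isotropic_gaussian_eq \<gamma>_def)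
  have \<gamma>w: "\<gamma> y * gibbs_weight \<delta> (\<phi> y) = c * w y" for y
    by (simp add: \<gamma>_def w_def c_def)
  have \<gamma>0: "\<gamma> y \<ge> 0" for y using t \<delta> by (simp add: \<gamma>_def)
  have [measurable]: "\<gamma> \<in> borel_measurable borel" unfolding \<gamma>_def by measurable
  \<comment> \<open>The integral of a non-integrable function is 0 by default, so a nonzero
    normalizer yields integrability, and with it measurability of the weight.\<close>
  have gi: "integrable (isotropic_gaussian x (\<delta> * t)) (\<lambda>y. gibbs_weight \<delta> (\<phi> y))"
    using N not_integrable_integral_eq unfolding hj_normalizer_def by blast
  then have [measurable]: "(\<lambda>y. gibbs_weight \<delta> (\<phi> y)) \<in> borel_measurable borel"
    unfolding ig by (auto dest: borel_measurable_integrable simp: measurable_def)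
  have wm[measurable]: "w \<in> borel_measurable borel" unfolding w_def by measurable
  have w0: "w y \<ge> 0" for y by (simp add: w_def gibbs_weight_def)
  have "integrable lborel (\<lambda>y. \<gamma> y *\<^sub>R gibbs_weight \<delta> (\<phi> y))"
    using gi unfolding ig by (subst (asm) integrable_density) (auto simp: \<gamma>0)
  then have wi: "integrable lborel w" using c by (simp add: \<gamma>w)
  have NW: "hj_normalizer \<phi> t \<delta> x = c * W"
    unfolding hj_normalizer_def ig W_def by (subst integral_density) (auto simp: \<gamma>0 \<gamma>w)
  have W: "W > 0" using N W_def Bochner_Integration.integral_nonneg[of lborel w] w0
    by (auto simp: NW less_le)
  have "(\<integral>y. gibbs_weight \<delta> (\<phi> y) *\<^sub>R y \<partial>isotropic_gaussian x (\<delta> * t)) = c *\<^sub>R (\<integral>y. w y *\<^sub>R y \<partial>lborel)"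
    unfolding ig by (subst integral_density) (auto simp: \<gamma>0 \<gamma>w mult.assoc simp flip: integral_scaleR_right)
  then have hp: "hj_prox \<phi> t \<delta> x = (\<integral>y. w y *\<^sub>R y \<partial>lborel) /\<^sub>R W"
    using c by (simp add: hj_prox_def NW)
  define v where "v y = w (p + (1/2) *\<^sub>R (y - p))" for y
  have v_eq: "v = (\<lambda>y. w ((1/2) *\<^sub>R p + (1/2) *\<^sub>R y))"
  proof
    fix y
    have "p + (1/2) *\<^sub>R (y - p) = (1/2) *\<^sub>R p + (1/2) *\<^sub>R y"
      using scaleR_half_double[of p] by (simp add: algebra_simps flip: scaleR_2)
    then show "v y = w ((1/2) *\<^sub>R p + (1/2) *\<^sub>R y)" by (simp add: v_def)
  qed
  have vi: "integrable lborel v" unfolding v_eq by (rule lborel_integrable_affine[OF _ wi]) simp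
  have vW: "(\<integral>y. v y \<partial>lborel) = 2 ^ DIM('a) * W"
    using lborel_integral_affine[OF _ wm, of "1/2" "(1/2) *\<^sub>R p"]
    unfolding W_def v_eq by (simp add: power_divide field_simps)
  \<comment> \<open>With \<open>l = 1/2\<close> the coefficient is
    \<open>3 / (8 * \<delta> * t)\<close>, which is weakened to
    \<open>1 / (4 * \<delta> * t)\<close>.\<close>
  have wv: "w y * (norm (y - p))\<^sup>2 \<le> (4 * \<delta> * t) * v y" for y
  proof -
    have "w y * (1 + (1 - (1/2)\<^sup>2) * (norm (y - p))\<^sup>2 / (2 * (\<delta> * t))) \<le> v y"
      using scaled_gibbs_weight_ge[OF \<phi> t \<delta> p, of "1/2" y] unfolding w_def v_def by simp
    moreover have "w y * ((norm (y - p))\<^sup>2 / (4 * \<delta> * t))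
        \<le> w y * (1 + (1 - (1/2)\<^sup>2) * (norm (y - p))\<^sup>2 / (2 * (\<delta> * t)))"
      using t \<delta> by (intro mult_left_mono w0) (simp add: field_simps power2_eq_square)
    ultimately have "w y * ((norm (y - p))\<^sup>2 / (4 * \<delta> * t)) \<le> v y" by linarith
    then show ?thesis using t \<delta> by (simp add: field_simps)
  qed
  define s where "s = sqrt \<delta>"
  have s: "s > 0" "s * s = \<delta>" using \<delta> by (simp_all add: s_def)
  \<comment> \<open>Bounding \<open>norm (y - p) * s\<close> by a sum of squares and dividing by
    \<open>s = sqrt \<delta>\<close> turns the second-moment bound of order \<open>\<delta>\<close>
    into a first-moment bound of order \<open>s\<close>.\<close>
  have amgm: "w y * norm (y - p) \<le> (4 * t * s) * v y + s * w y" for y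
  proof -
    have "norm (y - p) * s \<le> (norm (y - p))\<^sup>2 + s\<^sup>2"
      using sum_squares_bound[of "norm (y - p)" s] mult_nonneg_nonneg[OF norm_ge_zero less_imp_le[OF s(1)], of "y - p"]
      by linarith
    then have "w y * (norm (y - p) * s) \<le> w y * ((norm (y - p))\<^sup>2 + s\<^sup>2)"
      by (intro mult_left_mono w0)
    also have "\<dots> \<le> (4 * \<delta> * t) * v y + w y * s\<^sup>2" using wv[of y] by (simp add: distrib_left)
    also have "\<dots> = ((4 * t * s) * v y + s * w y) * s"
      by (simp add: s(2)[symmetric] algebra_simps power2_eq_square)
    finally show ?thesis using s(1) by (simp flip: mult.assoc)
  qed
  have bi: "integrable lborel (\<lambda>y. (4 * t * s) * v y + s * w y)"
    using vi wi by simp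
  have di: "integrable lborel (\<lambda>y. w y *\<^sub>R (y - p))"
    by (rule Bochner_Integration.integrable_bound[OF bi])
      (auto intro!: AE_I2 order_trans[OF amgm] simp: w0)
  \<comment> \<open>Recentring at \<open>p\<close> exhibits the error as the mean of
    \<open>y - p\<close> under the density \<open>w / W\<close>.\<close>
  have "(\<integral>y. w y *\<^sub>R y \<partial>lborel) = (\<integral>y. w y *\<^sub>R (y - p) + w y *\<^sub>R p \<partial>lborel)"
    by (simp add: algebra_simps)
  also have "\<dots> = (\<integral>y. w y *\<^sub>R (y - p) \<partial>lborel) + W *\<^sub>R p"
    using di wi by (subst Bochner_Integration.integral_add) (auto simp: W_def)
  finally have "hj_prox \<phi> t \<delta> x - p = (\<integral>y. w y *\<^sub>R (y - p) \<partial>lborel) /\<^sub>R W"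
    using W by (simp add: hp scaleR_add_right)
  then have "norm (hj_prox \<phi> t \<delta> x - p) = norm (\<integral>y. w y *\<^sub>R (y - p) \<partial>lborel) / W"
    using W by (simp add: divide_inverse mult.commute)
  also have "\<dots> \<le> (\<integral>y. norm (w y *\<^sub>R (y - p)) \<partial>lborel) / W"
    using W by (intro divide_right_mono integral_norm_bound) auto
  also have "\<dots> \<le> (\<integral>y. (4 * t * s) * v y + s * w y \<partial>lborel) / W"
    using W integrable_norm[OF di] bi amgm by (intro divide_right_mono integral_mono) (simp_all add: w0)
  \<comment> \<open>The mass of \<open>v\<close> is \<open>2 ^ DIM('a) * W\<close>, and the factor 4
    raises the exponent by 2.\<close>
  also have "(\<integral>y. (4 * t * s) * v y + s * w y \<partial>lborel) = ((t * 2 ^ (DIM('a) + 2) + 1) * s) * W"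
    using vi wi by (simp add: vW W_def[symmetric] algebra_simps)
  finally show ?thesis using W by (simp add: s_def)
qed

section \<open>Firmly nonexpansive iterations with summable errors\<close>

text \<open>Subtracting the partial sums of \<open>e\<close> makes the sequence decreasing; since
  these sums are bounded, it stays bounded below.\<close>

lemma quasi_Fejer_convergent:
  fixes a e :: "nat \<Rightarrow> real"
  assumes a0: "\<And>k. 0 \<le> a k" and step: "\<And>k. a (Suc k) \<le> a k + e k"
    and e: "summable e"
  shows "convergent a"
proof -
  define b where "b k = a k - (\<Sum>i<k. e i)" for k
  have S: "(\<lambda>k. \<Sum>i<k. e i) \<longlonglongrightarrow> suminf e" using e by (rule summable_LIMSEQ)
  from convergent_imp_Bseq[OF convergentI[OF this]]
  obtain M where M: "\<And>k. norm (\<Sum>i<k. e i) \<le> M" by (auto simp: Bseq_def)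
  have "decseq b" using step by (intro decseq_SucI) (simp add: b_def algebra_simps)
  moreover have "- M \<le> b k" for k using a0[of k] M[of k] by (simp add: b_def abs_le_iff)
  ultimately obtain L where "b \<longlonglongrightarrow> L" using decseq_convergent[of b "- M"] by blast
  from tendsto_add[OF this S] show ?thesis by (auto simp: b_def convergent_def)
qed

text \<open>An Opial-type argument: distances to every fixed point converge and the residual
  vanishes, so a cluster point is fixed; convergence of the distance to that cluster point then
  forces convergence of the whole sequence.\<close>

lemma inexact_firmly_nonexpansive_iteration:
  fixes T :: "'a::euclidean_space \<Rightarrow> 'a" and z :: "nat \<Rightarrow> 'a" and e :: "nat \<Rightarrow> real"
  assumes T: "\<And>x y. (norm (T x - T y))\<^sup>2 + (norm ((x - T x) - (y - T y)))\<^sup>2 \<le> (norm (x - y))\<^sup>2"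
    and fix0: "T q = q" and err: "\<And>k. norm (z (Suc k) - T (z k)) \<le> e k" and e: "summable e"
  obtains l where "T l = l" "z \<longlonglongrightarrow> l"
proof -
  have nonexp: "norm (T x - T y) \<le> norm (x - y)" for x y
  proof (rule power2_le_imp_le)
    show "(norm (T x - T y))\<^sup>2 \<le> (norm (x - y))\<^sup>2"
      using T[of x y] zero_le_power2[of "norm ((x - T x) - (y - T y))"] by linarith
  qed simp
  have e0: "e k \<ge> 0" for k using order_trans[OF norm_ge_zero err] .
  have conv: "convergent (\<lambda>k. norm (z k - l))" if "T l = l" for l
  proof (rule quasi_Fejer_convergent[OF _ _ e])
    fix k
    have "norm (z (Suc k) - l) \<le> norm (z (Suc k) - T (z k)) + norm (T (z k) - T l)"
      using norm_triangle_ineq[of "z (Suc k) - T (z k)" "T (z k) - T l"] that by simp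
    then show "norm (z (Suc k) - l) \<le> norm (z k - l) + e k"
      using err[of k] nonexp[of "z k" l] by linarith
  qed simp
  obtain L where L: "(\<lambda>k. norm (z k - q)) \<longlonglongrightarrow> L"
    using conv[OF fix0] by (auto simp: convergent_def)
  \<comment> \<open>Nonexpansiveness bounds these distances above by those of \<open>z k\<close>,
    and the error bound puts the distance of \<open>z (Suc k)\<close> minus \<open>e k\<close> below
    them.\<close>
  have TL: "(\<lambda>k. norm (T (z k) - q)) \<longlonglongrightarrow> L"
  proof (rule tendsto_sandwich[OF _ _ _ L])
    have "norm (z (Suc k) - q) \<le> norm (z (Suc k) - T (z k)) + norm (T (z k) - q)" for k
      using norm_triangle_ineq[of "z (Suc k) - T (z k)" "T (z k) - q"] by simp
    then have "norm (z (Suc k) - q) - e k \<le> norm (T (z k) - q)" for k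
      using err[of k] by (metis add_right_mono diff_le_eq add.commute order_trans)
    then show "\<forall>\<^sub>F k in sequentially. norm (z (Suc k) - q) - e k \<le> norm (T (z k) - q)" by simp
    show "\<forall>\<^sub>F k in sequentially. norm (T (z k) - q) \<le> norm (z k - q)"
      using nonexp[of _ q] by (simp add: fix0)
    show "(\<lambda>k. norm (z (Suc k) - q) - e k) \<longlonglongrightarrow> L"
      using tendsto_diff[OF LIMSEQ_Suc[OF L] summable_LIMSEQ_zero[OF e]] by simp
  qed
  \<comment> \<open>The hypothesis on \<open>T\<close> at the fixed point \<open>q\<close> bounds
    the squared residual by a difference of two sequences with common limit
    \<open>L^2\<close>.\<close>
  have "(\<lambda>k. (norm (z k - T (z k)))\<^sup>2) \<longlonglongrightarrow> 0"
  proof (rule tendsto_sandwich[OF _ _ tendsto_const])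
    show "\<forall>\<^sub>F k in sequentially. (norm (z k - T (z k)))\<^sup>2 \<le> (norm (z k - q))\<^sup>2 - (norm (T (z k) - q))\<^sup>2"
    proof (intro always_eventually allI)
      fix k
      show "(norm (z k - T (z k)))\<^sup>2 \<le> (norm (z k - q))\<^sup>2 - (norm (T (z k) - q))\<^sup>2"
        using T[of "z k" q] by (simp add: fix0)
    qed
    show "(\<lambda>k. (norm (z k - q))\<^sup>2 - (norm (T (z k) - q))\<^sup>2) \<longlonglongrightarrow> 0"
      using tendsto_diff[OF tendsto_power[OF L, of 2] tendsto_power[OF TL, of 2]] by simp
  qed simp
  then have res: "(\<lambda>k. z k - T (z k)) \<longlonglongrightarrow> 0"
    by (simp add: tendsto_norm_zero_iff)
  have "bounded (range (\<lambda>k. z k - q))"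
    using convergent_imp_Bseq[OF conv[OF fix0]] by (auto simp: Bseq_def bounded_iff)
  then have "bounded (range z)"
    using bounded_translation[of "range (\<lambda>k. z k - q)" q] by (simp add: image_image)
  then obtain l r where r: "strict_mono r" and lr: "(z \<circ> r) \<longlonglongrightarrow> l"
    using bounded_imp_convergent_subsequence[of z] by blast
  have "(\<lambda>k. norm (T (z (r k)) - T l)) \<longlonglongrightarrow> 0"
  proof (rule tendsto_sandwich[OF _ _ tendsto_const])
    show "\<forall>\<^sub>F k in sequentially. norm (T (z (r k)) - T l) \<le> norm (z (r k) - l)"
      by (simp add: nonexp)
    show "(\<lambda>k. norm (z (r k) - l)) \<longlonglongrightarrow> 0"
      using lr by (simp add: tendsto_norm_zero_iff LIM_zero o_def)
  qed simp
  then have "(\<lambda>k. T (z (r k))) \<longlonglongrightarrow> T l" by (simp add: tendsto_norm_zero_iff LIM_zero_iff)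
  with lr have "(\<lambda>k. z (r k) - T (z (r k))) \<longlonglongrightarrow> l - T l" by (auto intro: tendsto_diff simp: o_def)
  moreover have "(\<lambda>k. z (r k) - T (z (r k))) \<longlonglongrightarrow> 0"
    using LIMSEQ_subseq_LIMSEQ[OF res r] by (simp add: o_def)
  ultimately have "l - T l = 0" by (rule LIMSEQ_unique)
  then have Tl: "T l = l" by simp
  \<comment> \<open>As \<open>l\<close> is now known to be fixed, the distances to it converge;
    along \<open>r\<close> they tend to 0, so the full limit is 0.\<close>
  then obtain L' where L': "(\<lambda>k. norm (z k - l)) \<longlonglongrightarrow> L'"
    using conv by (auto simp: convergent_def)
  have "(\<lambda>k. norm (z (r k) - l)) \<longlonglongrightarrow> L'" using LIMSEQ_subseq_LIMSEQ[OF L' r] by (simp add: o_def)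
  moreover have "(\<lambda>k. norm (z (r k) - l)) \<longlonglongrightarrow> 0"
    using lr by (simp add: tendsto_norm_zero_iff LIM_zero o_def)
  ultimately have "L' = 0" by (rule LIMSEQ_unique)
  with L' have "z \<longlonglongrightarrow> l" by (simp add: tendsto_norm_zero_iff LIM_zero_iff)
  with Tl show thesis by (rule that)
qed

section \<open>Douglas-Rachford splitting\<close>

text \<open>\<open>a\<close>, \<open>b\<close>, \<open>c\<close> stand for differences of inputs, of
  \<open>f\<close>-prox values and of \<open>g\<close>-prox values at the reflected points. Left
  side minus right side equals twice \<open>b \<bullet> b - b \<bullet> a\<close> plus twice
  \<open>c \<bullet> c - c \<bullet> (2 *\<^sub>R b - a)\<close>.\<close>

lemma douglas_rachford_firmly_nonexpansive:
  fixes b c a :: "'a::real_inner"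
  assumes "b \<bullet> b \<le> b \<bullet> a" "c \<bullet> c \<le> c \<bullet> (2 *\<^sub>R b - a)"
  shows "(norm (a + c - b))\<^sup>2 + (norm (b - c))\<^sup>2 \<le> (norm a)\<^sup>2"
  using assms unfolding power2_norm_eq_inner
  by (simp add: inner_simps inner_commute)

text \<open>The opposite subgradients in \<open>zero_of_sum\<close> give both the affine minorants
  behind the exact proximal maps and a fixed point of the exact operator. The recursion starts at an
  arbitrary \<open>z 1\<close>, hence the shifts by \<open>Suc\<close>.\<close>

theorem theorem4:
  fixes f g :: "real ^ 'n \<Rightarrow> ereal"
    and t :: real
    and \<delta> :: "nat \<Rightarrow> real"
    and x xhalf z :: "nat \<Rightarrow> real ^ 'n"
  assumes f: "proper f" "convex_ereal f" "lower_semicontinuous f"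
    and g: "proper g" "convex_ereal g" "lower_semicontinuous g"
    and t: "t > 0"
    and delta_pos: "\<And>k. k \<ge> 1 \<Longrightarrow> \<delta> k > 0"
    and delta_summable: "summable (\<lambda>k. sqrt (\<delta> k))"
    and zero_of_sum: "\<exists>p u. u \<in> subdifferential f p \<and> - u \<in> subdifferential g p"
    and well_defined_f: "\<And>k. k \<ge> 1 \<Longrightarrow> hj_normalizer f t (\<delta> k) (z k) \<noteq> 0"
    and well_defined_g: "\<And>k. k \<ge> 1 \<Longrightarrow> hj_normalizer g t (\<delta> k) (2 *\<^sub>R xhalf k - z k) \<noteq> 0"
    and xhalf_step: "\<And>k. k \<ge> 1 \<Longrightarrow> xhalf k = hj_prox f t (\<delta> k) (z k)"
    and x_step: "\<And>k. k \<ge> 1 \<Longrightarrow> x (Suc k) = hj_prox g t (\<delta> k) (2 *\<^sub>R xhalf k - z k)"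
    and z_step: "\<And>k. k \<ge> 1 \<Longrightarrow> z (Suc k) = z k + x (Suc k) - xhalf k"
  shows "\<exists>p. is_arg_min (\<lambda>y. f y + g y) (\<lambda>_. True) p \<and> x \<longlonglongrightarrow> p"
proof -
  obtain q u where q: "u \<in> subdifferential f q" "- u \<in> subdifferential g q" using zero_of_sum by blast
  \<comment> \<open>\<open>F\<close> and \<open>G\<close> are the exact proximal maps of
    \<open>f\<close> and \<open>g\<close>, selected through the optimality inclusion.\<close>
  define F where "F v = (SOME p. (v - p) /\<^sub>R t \<in> subdifferential f p)" for v
  define G where "G v = (SOME p. (v - p) /\<^sub>R t \<in> subdifferential g p)" for v
  have F: "(v - F v) /\<^sub>R t \<in> subdifferential f (F v)" for v
    unfolding F_def by (rule someI_ex) (rule prox_exists[OF f t q(1)])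
  have G: "(v - G v) /\<^sub>R t \<in> subdifferential g (G v)" for v
    unfolding G_def by (rule someI_ex) (rule prox_exists[OF g t q(2)])
  define T where "T v = v + G (2 *\<^sub>R F v - v) - F v" for v
  have T: "(norm (T v - T w))\<^sup>2 + (norm ((v - T v) - (w - T w)))\<^sup>2 \<le> (norm (v - w))\<^sup>2" for v w
  proof -
    have "(norm ((v - w) + (G (2 *\<^sub>R F v - v) - G (2 *\<^sub>R F w - w)) - (F v - F w)))\<^sup>2
        + (norm ((F v - F w) - (G (2 *\<^sub>R F v - v) - G (2 *\<^sub>R F w - w))))\<^sup>2 \<le> (norm (v - w))\<^sup>2"
      using prox_firmly_nonexpansive[OF f(1) t F F, of v w]
        prox_firmly_nonexpansive[OF g(1) t G G, of "2 *\<^sub>R F v - v" "2 *\<^sub>R F w - w"]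
      by (intro douglas_rachford_firmly_nonexpansive) (simp_all add: algebra_simps)
    then show ?thesis by (simp add: T_def algebra_simps)
  qed
  \<comment> \<open>\<open>q\<close> satisfies the inclusion for \<open>f\<close> at
    \<open>q + t *\<^sub>R u\<close> and for \<open>g\<close> at its reflection
    \<open>q - t *\<^sub>R u\<close>; uniqueness of proximal points then gives the fixed
    point.\<close>
  have Fq: "F (q + t *\<^sub>R u) = q"
    using prox_nonexpansive[OF f(1) t F, of "q + t *\<^sub>R u" q "q + t *\<^sub>R u"] q(1) t by simp
  have "G (q - t *\<^sub>R u) = q"
    using prox_nonexpansive[OF g(1) t G, of "q - t *\<^sub>R u" q "q - t *\<^sub>R u"] q(2) t by simp
  then have Tq: "T (q + t *\<^sub>R u) = q + t *\<^sub>R u"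
    by (simp add: T_def Fq scaleR_2)
  define C where "C = t * 2 ^ (DIM(real ^ 'n) + 2) + 1"
  have xh: "norm (xhalf k - F (z k)) \<le> C * sqrt (\<delta> k)" if "k \<ge> 1" for k
    using hj_prox_error[OF f(1,2) t delta_pos F well_defined_f] that by (simp add: xhalf_step C_def)
  \<comment> \<open>The factor 4 counts one error from the prox of \<open>g\<close>, one from
    \<open>xhalf\<close> directly, and two from \<open>xhalf\<close> doubled by the reflection and
    passed through the nonexpansive \<open>G\<close>.\<close>
  have err: "norm (z (Suc (Suc k)) - T (z (Suc k))) \<le> 4 * C * sqrt (\<delta> (Suc k))" for k
  proof -
    define z' where "z' = z (Suc k)"
    define y where "y = 2 *\<^sub>R xhalf (Suc k) - z'"
    define y' where "y' = 2 *\<^sub>R F z' - z'"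
    have e1: "norm (xhalf (Suc k) - F z') \<le> C * sqrt (\<delta> (Suc k))"
      using xh[of "Suc k"] by (simp add: z'_def)
    have e2: "norm (x (Suc (Suc k)) - G y) \<le> C * sqrt (\<delta> (Suc k))"
      using hj_prox_error[OF g(1,2) t delta_pos G well_defined_g, of "Suc k"]
      by (simp add: x_step C_def y_def z'_def)
    have "norm (G y - G y') \<le> norm (y - y')" by (rule prox_nonexpansive[OF g(1) t G G])
    also have "y - y' = 2 *\<^sub>R (xhalf (Suc k) - F z')" by (simp add: y_def y'_def algebra_simps)
    finally have e3: "norm (G y - G y') \<le> 2 * norm (xhalf (Suc k) - F z')" by simp
    have zT: "z (Suc (Suc k)) - T z'
        = (x (Suc (Suc k)) - G y) + (G y - G y') - (xhalf (Suc k) - F z')"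
      by (simp add: z_step T_def z'_def y'_def)
    have "norm (z (Suc (Suc k)) - T z')
        \<le> norm (x (Suc (Suc k)) - G y) + norm (G y - G y') + norm (xhalf (Suc k) - F z')"
      unfolding zT
      using norm_triangle_ineq4[of "(x (Suc (Suc k)) - G y) + (G y - G y')" "xhalf (Suc k) - F z'"]
        norm_triangle_ineq[of "x (Suc (Suc k)) - G y" "G y - G y'"] by linarith
    then show ?thesis using e1 e2 e3 by (simp add: z'_def)
  qed
  have "summable (\<lambda>k. 4 * C * sqrt (\<delta> (Suc k)))"
    using delta_summable by (intro summable_mult) (simp add: summable_Suc_iff[of "\<lambda>k. sqrt (\<delta> k)"])
  from inexact_firmly_nonexpansive_iteration[OF T Tq, of "\<lambda>k. z (Suc k)", OF err this]
  obtain l where Tl: "T l = l" and zl: "(\<lambda>k. z (Suc k)) \<longlonglongrightarrow> l" by blast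
  define p where "p = F l"
  have Gp: "G (2 *\<^sub>R p - l) = p" using Tl by (simp add: T_def p_def)
  have "(\<lambda>k. norm (F (z (Suc k)) - p)) \<longlonglongrightarrow> 0"
  proof (rule tendsto_sandwich[OF _ _ tendsto_const])
    show "\<forall>\<^sub>F k in sequentially. norm (F (z (Suc k)) - p) \<le> norm (z (Suc k) - l)"
      by (simp add: p_def prox_nonexpansive[OF f(1) t F F])
    show "(\<lambda>k. norm (z (Suc k) - l)) \<longlonglongrightarrow> 0"
      using zl by (simp add: tendsto_norm_zero_iff LIM_zero)
  qed simp
  then have Fp: "(\<lambda>k. F (z (Suc k))) \<longlonglongrightarrow> p" by (simp add: tendsto_norm_zero_iff LIM_zero_iff)
  have "(\<lambda>k. C * sqrt (\<delta> (Suc k))) \<longlonglongrightarrow> 0"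
    using tendsto_mult_right_zero[OF LIMSEQ_Suc[OF summable_LIMSEQ_zero[OF delta_summable]]] .
  then have "(\<lambda>k. xhalf (Suc k) - F (z (Suc k))) \<longlonglongrightarrow> 0"
    by (rule Lim_null_comparison[rotated]) (simp add: xh)
  from tendsto_add[OF this Fp] have "(\<lambda>k. xhalf (Suc k)) \<longlonglongrightarrow> p" by simp
  \<comment> \<open>Solving the \<open>z\<close> update for \<open>x\<close> gives
    \<open>xhalf\<close> plus an increment of \<open>z\<close>, and the increments vanish.\<close>
  from tendsto_add[OF tendsto_diff[OF LIMSEQ_Suc[OF zl] zl] this]
  have "(\<lambda>k. x (Suc (Suc k))) \<longlonglongrightarrow> p" by (simp add: z_step)
  then have "x \<longlonglongrightarrow> p" by (simp add: filterlim_sequentially_Suc[of x] filterlim_sequentially_Suc[of "\<lambda>k. x (Suc k)"])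
  moreover have "f p + g p \<le> f y + g y" for y
  proof -
    obtain a where a: "f p = ereal a" using subdifferential_finite[OF f(1) F] p_def by metis
    obtain b where b: "g p = ereal b" using subdifferential_finite[OF g(1) G] Gp by metis
    \<comment> \<open>At the fixed point \<open>l\<close>, the vector
      \<open>(l - p) /\<^sub>R t\<close> is a subgradient of \<open>f\<close> at \<open>p\<close>
      and its negative one of \<open>g\<close>, so the linear terms cancel in the sum.\<close>
    define s where "s = ((l - p) /\<^sub>R t) \<bullet> (y - p)"
    have "ereal (a + s) \<le> f y"
      using subdifferentialD[OF F[of l], of y] by (simp add: a s_def flip: p_def)
    moreover have "(p - l) /\<^sub>R t \<in> subdifferential g p"
      using G[of "2 *\<^sub>R p - l"] unfolding Gp by (simp add: scaleR_2)
    then have "ereal (b + ((p - l) /\<^sub>R t) \<bullet> (y - p)) \<le> g y"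
      using subdifferentialD by (fastforce simp: b)
    moreover have "((p - l) /\<^sub>R t) \<bullet> (y - p) = - s"
      by (simp add: s_def inner_simps algebra_simps)
    ultimately have "ereal (a + s) + ereal (b - s) \<le> f y + g y" by (intro add_mono) auto
    then show ?thesis by (simp add: a b)
  qed
  ultimately show ?thesis by (auto simp: is_arg_min_def not_less)
qed

end
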